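(* Let $D$ and $N$ be positive integers and let $\mu_1, \mu_2, \ldots, \mu_D$ be fixed real parameters. Let $\mathscr{C}^{(D)} = \left[C^{(D)}_{i_1, i_2, \ldots, i_D}\right]$ be the $D$-dimensional tensor of size $N \times N \times \cdots \times N$ with elements $$C^{(D)}_{i_1, i_2, \ldots, i_D} = \sum_{\sigma} i_{\sigma(1)}^{\mu_1} \cdot i_{\sigma(2)}^{\mu_2} \cdots i_{\sigma(D)}^{\mu_D}, \qquad 1 \le i_1, \ldots, i_D \le N,$$ where the sum is over all permutations $\sigma$ of the set $\{1, 2, \ldots, D\}$. Then the TT-ranks $R_\lambda$ of $\mathscr{C}^{(D)}$ satisfy $$R_\lambda \le \binom{D}{\lambda} = \frac{D!}{\lambda!\,(D-\lambda)!}, \qquad 0 \le \lambda \le D;$$ that is, $\mathscr{C}^{(D)}$ admits a TT-decomposition whose ranks $R_0, R_1, \ldots, R_D$ satisfy all of these inequalities simultaneously.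
   Context: A TT-decomposition (tensor train decomposition) with ranks $R_0, R_1, \ldots, R_D$ (positive integers with $R_0 = R_D = 1$) of a real $D$-dimensional tensor $\mathscr{C}^{(D)} = \left[C^{(D)}_{i_1, \ldots, i_D}\right]$ of size $N \times \cdots \times N$ is a representation, valid for all $1 \le i_1, \ldots, i_D \le N$, of the form $$C^{(D)}_{i_1, \ldots, i_D} = \sum_{r_0, r_1, \ldots, r_D} H^{(1)}_{r_0, i_1, r_1} \cdot H^{(2)}_{r_1, i_2, r_2} \cdots H^{(D)}_{r_{D-1}, i_D, r_D},$$ where the sum is over all integers $r_0, \ldots, r_D$ with $1 \le r_\lambda \le R_\lambda$ for $0 \le \lambda \le D$, and where, for each $1 \le \lambda \le D$, $H^{(\lambda)} = \left[H^{(\lambda)}_{r_{\lambda-1}, i_\lambda, r_\lambda}\right]$ is a real array of size $R_{\lambda-1} \times N \times R_\lambda$. An upper bound on the TT-ranks of a tensor means the existence of a TT-decomposition of it with ranks satisfying that bound. *)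

theory Defs
  imports Complex_Main "HOL-Library.FuncSet" "HOL-Combinatorics.Permutations"
begin

text \<open>
  A multi-index \<open>(i\<^sub>1, \<dots>, i\<^sub>D)\<close> is an extensional function on \<open>{1..D}\<close>. A tensor of
  dimension \<open>D\<close> and size \<open>N \<times> \<dots> \<times> N\<close> is a function of multi-indices; only its values on
  \<open>multi_indices D N\<close> matter.
\<close>

type_synonym tensor = "(nat \<Rightarrow> nat) \<Rightarrow> real"

definition multi_indices :: "nat \<Rightarrow> nat \<Rightarrow> (nat \<Rightarrow> nat) set" where
  "multi_indices D N = {1..D} \<rightarrow>\<^sub>E {1..N}"

text \<open>
  \<open>H l a j b\<close> is the entry at position \<open>(a, j, b)\<close> of the \<open>l\<close>-th core, an array of size
  \<open>R (l - 1) \<times> N \<times> R l\<close>; values outside this range are never used.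
\<close>

definition tt_decomposition ::
    "nat \<Rightarrow> nat \<Rightarrow> (nat \<Rightarrow> nat) \<Rightarrow> (nat \<Rightarrow> nat \<Rightarrow> nat \<Rightarrow> nat \<Rightarrow> real) \<Rightarrow> tensor \<Rightarrow> bool" where
  "tt_decomposition D N R H C \<longleftrightarrow>
     (\<forall>l\<in>{0..D}. 1 \<le> R l) \<and> R 0 = 1 \<and> R D = 1 \<and>
     (\<forall>i\<in>multi_indices D N.
        C i = (\<Sum>r\<in>(\<Pi>\<^sub>E l\<in>{0..D}. {1..R l}). \<Prod>l=1..D. H l (r (l - 1)) (i l) (r l)))"

definition sym_power_tensor :: "nat \<Rightarrow> (nat \<Rightarrow> real) \<Rightarrow> tensor" where
  "sym_power_tensor D \<mu> i =
     (\<Sum>\<sigma> | \<sigma> permutes {1..D}. \<Prod>k=1..D. real (i (\<sigma> k)) powr \<mu> k)"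

end

theory Submission
  imports Defs
begin

text \<open>
  Put \<open>y l k = i\<^sub>l powr \<mu>\<^sub>k\<close>. Reindexing by \<open>\<tau> = inv \<sigma>\<close> turns the entry of the tensor
  into the permanent \<open>\<Sum>\<tau>. \<Prod>l. y l (\<tau> l)\<close>. A permutation \<open>\<tau>\<close> of \<open>{1..D}\<close> is the same
  thing as a maximal chain of subsets \<open>{} = S\<^sub>0 \<subset> S\<^sub>1 \<subset> \<dots> \<subset> S\<^sub>D = {1..D}\<close>, namely
  \<open>S\<^sub>l = \<tau> ` {1..l}\<close>: the set \<open>S\<^sub>l\<close> records which exponents the first \<open>l\<close> indices have used.
  The factor \<open>y l (\<tau> l)\<close> depends only on \<open>i\<^sub>l\<close> and on the two consecutive sets \<open>S\<^sub>l\<^sub>-\<^sub>1\<close> and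
  \<open>S\<^sub>l\<close>, whose difference is \<open>{\<tau> l}\<close>. So the permanent is a sum over paths of products of
  transition weights, which is a tensor train whose \<open>l\<close>-th bond index runs over the
  \<open>l\<close>-element subsets of \<open>{1..D}\<close>; there are \<open>D choose l\<close> of them.

  The expansion of the permanent is \<open>permanent_eq_sum_chains\<close>; the passage from bond indices
  in arbitrary finite sets to bond indices in \<open>{1..R l}\<close> is \<open>tt_decomposition_of_states\<close>.
\<close>

text \<open>
  The bond indices of a tensor train are mere labels: summing over an arbitrary finite set of
  states at each bond gives a decomposition whose ranks are the numbers of states, after
  numbering the states.
\<close>

lemma tt_decomposition_of_states:
  fixes St :: "nat \<Rightarrow> 's set" and G :: "nat \<Rightarrow> 's \<Rightarrow> nat \<Rightarrow> 's \<Rightarrow> real"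
  assumes fin: "\<And>l. l \<le> D \<Longrightarrow> finite (St l)"
    and ne: "\<And>l. l \<le> D \<Longrightarrow> St l \<noteq> {}"
    and ends: "card (St 0) = 1" "card (St D) = 1"
    and C: "\<And>i. i \<in> multi_indices D N \<Longrightarrow>
      C i = (\<Sum>s\<in>(\<Pi>\<^sub>E l\<in>{0..D}. St l). \<Prod>l=1..D. G l (s (l - 1)) (i l) (s l))"
  shows "\<exists>H. tt_decomposition D N (\<lambda>l. card (St l)) H C"
proof -
  have "\<forall>l. \<exists>e. l \<le> D \<longrightarrow> bij_betw e {1..card (St l)} (St l)"
    using ex_bij_betw_nat_finite_1[OF fin] by blast
  then obtain e where e: "\<And>l. l \<le> D \<Longrightarrow> bij_betw (e l) {1..card (St l)} (St l)"
    by metis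
  define H where "H l a j b = G l (e (l - 1) a) j (e l b)" for l a j b
  let ?R = "\<Pi>\<^sub>E l\<in>{0..D}. {1..card (St l)}"
  let ?S = "\<Pi>\<^sub>E l\<in>{0..D}. St l"
  have "(\<Sum>s\<in>?S. \<Prod>l=1..D. G l (s (l - 1)) (i l) (s l)) =
        (\<Sum>r\<in>?R. \<Prod>l=1..D. H l (r (l - 1)) (i l) (r l))" for i
  proof (rule sum.reindex_bij_witness
      [where i = "\<lambda>r. \<lambda>l\<in>{0..D}. e l (r l)"
         and j = "\<lambda>s. \<lambda>l\<in>{0..D}. inv_into {1..card (St l)} (e l) (s l)"])
    fix s assume s: "s \<in> ?S"
    have sl: "s l \<in> e l ` {1..card (St l)}" if "l \<le> D" for l
      using s e[OF that] that by (auto simp: bij_betw_def)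
    have inv: "e l (inv_into {1..card (St l)} (e l) (s l)) = s l" if "l \<le> D" for l
      using f_inv_into_f[OF sl[OF that]] .
    show "(\<lambda>l\<in>{0..D}. e l ((\<lambda>l\<in>{0..D}. inv_into {1..card (St l)} (e l) (s l)) l)) = s"
      using s inv by (intro extensionalityI[of _ "{0..D}"]) (auto simp: PiE_def)
    show "(\<lambda>l\<in>{0..D}. inv_into {1..card (St l)} (e l) (s l)) \<in> ?R"
      using inv_into_into[OF sl] by (intro restrict_PiE_iff[THEN iffD2]) auto
    show "(\<Prod>l=1..D. H l ((\<lambda>l\<in>{0..D}. inv_into {1..card (St l)} (e l) (s l)) (l - 1)) (i l)
             ((\<lambda>l\<in>{0..D}. inv_into {1..card (St l)} (e l) (s l)) l)) =
          (\<Prod>l=1..D. G l (s (l - 1)) (i l) (s l))"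
      by (intro prod.cong) (auto simp: H_def inv[simplified])
  next
    fix r assume r: "r \<in> ?R"
    have rl: "r l \<in> {1..card (St l)}" if "l \<le> D" for l
      using r that by (auto simp: PiE_iff)
    have inv: "inv_into {1..card (St l)} (e l) (e l (r l)) = r l" if "l \<le> D" for l
      using bij_betw_imp_inj_on[OF e[OF that]] rl[OF that] by (rule inv_into_f_f)
    show "(\<lambda>l\<in>{0..D}. inv_into {1..card (St l)} (e l) ((\<lambda>l\<in>{0..D}. e l (r l)) l)) = r"
      using r inv by (intro extensionalityI[of _ "{0..D}"]) (auto simp: PiE_def)
    show "(\<lambda>l\<in>{0..D}. e l (r l)) \<in> ?S"
      using bij_betw_apply[OF e rl] by auto
  qed
  then have "tt_decomposition D N (\<lambda>l. card (St l)) H C"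
    unfolding tt_decomposition_def using fin ne ends C by (simp add: Suc_le_eq card_gt_0_iff)
  then show ?thesis by blast
qed

text \<open>
  A path that is not increasing has weight \<open>0\<close>; the others are the maximal chains, and
  \<open>\<tau> \<mapsto> (\<lambda>l. \<tau> ` {1..l})\<close> is a bijection from the permutations onto them: the chain determines \<open>\<tau> l\<close> as the element that
  enters at step \<open>l\<close>.
\<close>

lemma permanent_eq_sum_chains:
  fixes y :: "nat \<Rightarrow> nat \<Rightarrow> 'a::comm_semiring_1"
  shows "(\<Sum>\<tau> | \<tau> permutes {1..D}. \<Prod>l=1..D. y l (\<tau> l)) =
    (\<Sum>S\<in>(\<Pi>\<^sub>E l\<in>{0..D}. {A. A \<subseteq> {1..D} \<and> card A = l}).
       \<Prod>l=1..D. if S (l - 1) \<subseteq> S l then y l (the_elem (S l - S (l - 1))) else 0)"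
    (is "?lhs = (\<Sum>S\<in>?P. ?w S)")
proof -
  define chain where "chain \<tau> = (\<lambda>l\<in>{0..D}. \<tau> ` {1..l})" for \<tau> :: "nat \<Rightarrow> nat"
  let ?T = "{\<tau>. \<tau> permutes {1..D}}"
  have step: "\<tau> ` {1..l} - \<tau> ` {1..l - 1} = {\<tau> l}"
    if "\<tau> permutes {1..D}" "l \<in> {1..D}" for \<tau> l
  proof -
    have "\<tau> ` {1..l} - \<tau> ` {1..l - 1} = \<tau> ` ({1..l} - {1..l - 1})"
      using permutes_inj[OF that(1)] by (simp add: image_set_diff)
    also have "{1..l} - {1..l - 1} = {l}" using that(2) by auto
    finally show ?thesis by simp
  qed
  have inj: "inj_on chain ?T"
  proof (rule inj_onI)
    fix \<sigma> \<tau> assume p: "\<sigma> \<in> ?T" "\<tau> \<in> ?T" and eq: "chain \<sigma> = chain \<tau>"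
    have im: "\<sigma> ` {1..l} = \<tau> ` {1..l}" if "l \<le> D" for l
      using fun_cong[OF eq, of l] that by (simp add: chain_def)
    show "\<sigma> = \<tau>"
    proof
      fix l
      show "\<sigma> l = \<tau> l"
      proof (cases "l \<in> {1..D}")
        case True
        then have "{\<sigma> l} = {\<tau> l}"
          using step[of \<sigma> l] step[of \<tau> l] p im[of l] im[of "l - 1"] by auto
        then show ?thesis by simp
      next
        case False
        then show ?thesis using p by (auto simp: permutes_def)
      qed
    qed
  qed
  have sub: "chain ` ?T \<subseteq> ?P"
  proof (clarsimp simp: chain_def)
    fix \<tau> l assume p: "\<tau> permutes {Suc 0..D}" and l: "l \<le> D"
    have "\<tau> ` {Suc 0..l} \<subseteq> \<tau> ` {Suc 0..D}" using l by auto
    then show "\<tau> ` {Suc 0..l} \<subseteq> {Suc 0..D} \<and> card (\<tau> ` {Suc 0..l}) = l"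
      using permutes_image[OF p] card_image[OF permutes_inj_on[OF p]] by simp
  qed
  have surj: "S \<in> chain ` ?T" if S: "S \<in> ?P" and nz: "?w S \<noteq> 0" for S
  proof -
    have Sl: "S l \<subseteq> {1..D}" "card (S l) = l" if "l \<le> D" for l
      using S that by (auto simp: PiE_iff)
    have mono: "S (l - 1) \<subseteq> S l" if "l \<in> {1..D}" for l
    proof (rule ccontr)
      assume "\<not> ?thesis"
      then have "?w S = 0" using that by (intro prod_zero) auto
      with nz show False by simp
    qed
    define \<tau> where "\<tau> l = (if l \<in> {1..D} then the_elem (S l - S (l - 1)) else l)" for l
    have new: "S l = insert (\<tau> l) (S (l - 1))" if l: "l \<in> {1..D}" for l
    proof -
      have "finite (S (l - 1))" using Sl(1)[of "l - 1"] l finite_subset by fastforce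
      then have "card (S l - S (l - 1)) = 1"
        using card_Diff_subset[OF _ mono[OF l]] Sl(2)[of l] Sl(2)[of "l - 1"] l by auto
      then obtain k where "S l - S (l - 1) = {k}" by (auto simp: card_1_singleton_iff)
      with l mono[OF l] show ?thesis by (auto simp: \<tau>_def)
    qed
    have im: "\<tau> ` {1..l} = S l" if "l \<le> D" for l
      using that
    proof (induction l)
      case 0
      have "finite (S 0)" using Sl(1)[of 0] finite_subset by blast
      then show ?case using Sl(2)[of 0] by simp
    next
      case (Suc l)
      then show ?case using new[of "Suc l"] by (simp add: atLeastAtMostSuc_conv)
    qed
    have "S D = {1..D}" using card_subset_eq[of "{1..D}" "S D"] Sl[of D] by simp
    then have "\<tau> ` {1..D} = {1..D}" using im[of D] by simp
    then have "bij_betw \<tau> {1..D} {1..D}"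
      by (simp add: bij_betw_def eq_card_imp_inj_on)
    then have "\<tau> permutes {1..D}" by (rule bij_imp_permutes) (auto simp: \<tau>_def)
    moreover have "S = chain \<tau>"
      using S im by (intro extensionalityI[of _ "{0..D}"]) (auto simp: PiE_def chain_def)
    ultimately show ?thesis by blast
  qed
  have "(\<Sum>S\<in>?P. ?w S) = (\<Sum>S\<in>chain ` ?T. ?w S)"
    using sub surj by (intro sum.mono_neutral_right) (auto intro!: finite_PiE)
  also have "\<dots> = (\<Sum>\<tau>\<in>?T. ?w (chain \<tau>))"
    using inj by (simp add: sum.reindex)
  also have "\<dots> = ?lhs"
  proof (intro sum.cong prod.cong refl)
    fix \<tau> l assume \<tau>: "\<tau> \<in> ?T" and l: "l \<in> {1..D}"
    have c: "chain \<tau> l = \<tau> ` {1..l}" "chain \<tau> (l - 1) = \<tau> ` {1..l - 1}"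
      using l by (auto simp: chain_def)
    moreover have "\<tau> ` {1..l - 1} \<subseteq> \<tau> ` {1..l}" by auto
    ultimately show "(if chain \<tau> (l - 1) \<subseteq> chain \<tau> l
        then y l (the_elem (chain \<tau> l - chain \<tau> (l - 1))) else 0) = y l (\<tau> l)"
      using step[of \<tau> l] \<tau> l by simp
  qed
  finally show ?thesis ..
qed

lemma sym_power_tensor_eq_permanent:
  "sym_power_tensor D \<mu> i =
     (\<Sum>\<tau> | \<tau> permutes {1..D}. \<Prod>l=1..D. real (i l) powr \<mu> (\<tau> l))"
proof -
  have "sym_power_tensor D \<mu> i =
      (\<Sum>\<tau> | \<tau> permutes {1..D}. \<Prod>k=1..D. real (i (inv \<tau> k)) powr \<mu> k)"
    unfolding sym_power_tensor_def by (rule sum_permutations_inverse)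
  also have "\<dots> = (\<Sum>\<tau> | \<tau> permutes {1..D}. \<Prod>l=1..D. real (i l) powr \<mu> (\<tau> l))"
  proof (rule sum.cong[OF refl])
    fix \<tau> assume "\<tau> \<in> {\<tau>. \<tau> permutes {1..D}}"
    then have p: "\<tau> permutes {1..D}" by simp
    show "(\<Prod>k=1..D. real (i (inv \<tau> k)) powr \<mu> k) = (\<Prod>l=1..D. real (i l) powr \<mu> (\<tau> l))"
      using prod.permute[OF p, of "\<lambda>k. real (i (inv \<tau> k)) powr \<mu> k"]
      by (simp add: o_def permutes_inverses[OF p])
  qed
  finally show ?thesis .
qed

theorem theorem1:
  fixes D N :: nat and \<mu> :: "nat \<Rightarrow> real"
  assumes "1 \<le> D" and "1 \<le> N"
  shows "\<exists>R H. tt_decomposition D N R H (sym_power_tensor D \<mu>) \<and>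
           (\<forall>l\<in>{0..D}. R l \<le> D choose l)"
proof -
  define St where "St l = {A. A \<subseteq> {1..D} \<and> card A = l}" for l
  define G where "G l S j T = (if S \<subseteq> T then real j powr \<mu> (the_elem (T - S)) else 0)"
    for l j :: nat and S T :: "nat set"
  have fin: "finite (St l)" for l by (simp add: St_def)
  have card: "card (St l) = D choose l" for l
    using n_subsets[of "{1..D}" l] by (simp add: St_def)
  have "\<exists>H. tt_decomposition D N (\<lambda>l. card (St l)) H (sym_power_tensor D \<mu>)"
  proof (rule tt_decomposition_of_states[where G = G])
    show "St l \<noteq> {}" if "l \<le> D" for l
      using card[of l] zero_less_binomial[OF that] by auto
    show "sym_power_tensor D \<mu> i =
        (\<Sum>s\<in>(\<Pi>\<^sub>E l\<in>{0..D}. St l). \<Prod>l=1..D. G l (s (l - 1)) (i l) (s l))" for i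
      unfolding sym_power_tensor_eq_permanent St_def G_def
      by (rule permanent_eq_sum_chains)
  qed (simp_all add: fin card)
  then show ?thesis using card by auto
qed

end
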